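(* Assume the Continuum Hypothesis. Let $X$ be a weakly Lindelöf determined (WLD) Banach space of density character $\omega_1$. Then there exists a dense linear subspace $Y$ of $X$ that contains no uncountable biorthogonal system.
   Context: "Subspace" means linear subspace, not necessarily closed. A biorthogonal system in a normed space $Y$ is a family $\{y_\gamma;y_\gamma^*\}_{\gamma\in\Gamma}\subseteq Y\times Y^*$ with $\langle y_\alpha^*,y_\beta\rangle=\delta_{\alpha,\beta}$ for all $\alpha,\beta\in\Gamma$; it is uncountable if $\Gamma$ is uncountable. A biorthogonal system $\{x_\gamma;x_\gamma^*\}_{\gamma\in\Gamma}$ in a Banach space $X$ is an M-basis for $X$ if moreover $\overline{\mathrm{span}}\{x_\gamma\}_{\gamma\in\Gamma}=X$ and $\overline{\mathrm{span}}^{w^*}\{x_\gamma^*\}_{\gamma\in\Gamma}=X^*$. A Banach space $X$ is weakly Lindelöf determined (WLD) if it admits an M-basis $\{x_\gamma;x_\gamma^*\}_{\gamma\in\Gamma}$ such that for every $x^*\in X^*$ the set $\{\gamma\in\Gamma:\langle x^*,x_\gamma\rangle\neq0\}$ is countable. The density character of $X$ is the smallest cardinality of a dense subset of $X$. *)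

theory Defs
  imports "HOL-Analysis.Analysis"
begin

unbundle cardinal_syntax

definition continuum_hypothesis :: bool where
  "continuum_hypothesis \<longleftrightarrow> |UNIV :: real set| =o cardSuc natLeq"

definition has_density_character :: "'a::topological_space set \<Rightarrow> 'k rel \<Rightarrow> bool" where
  "has_density_character X \<kappa> \<longleftrightarrow>
     (\<exists>D. D \<subseteq> X \<and> X \<subseteq> closure D \<and> |D| =o \<kappa>) \<and>
     (\<forall>D. D \<subseteq> X \<and> X \<subseteq> closure D \<longrightarrow> \<kappa> \<le>o |D| )"

(* Bounded linear functionals on a linear subspace Y, represented by functions on the whole
   type of which only the values on Y matter. *)
definition dual_on :: "'a::real_normed_vector set \<Rightarrow> ('a \<Rightarrow> real) set" where
  "dual_on Y = {f. (\<forall>x\<in>Y. \<forall>y\<in>Y. f (x + y) = f x + f y) \<and>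
                   (\<forall>c. \<forall>x\<in>Y. f (c *\<^sub>R x) = c * f x) \<and>
                   (\<exists>K. \<forall>x\<in>Y. \<bar>f x\<bar> \<le> K * norm x)}"

lemma dual_on_UNIV: "dual_on UNIV = {f. bounded_linear f}"
proof -
  have "f \<in> dual_on UNIV \<longleftrightarrow> bounded_linear f" for f :: "'a \<Rightarrow> real"
    unfolding dual_on_def bounded_linear_def bounded_linear_axioms_def linear_iff
    by (auto simp: mult.commute)
  then show ?thesis by blast
qed

definition biorthogonal_system ::
  "'a::real_normed_vector set \<Rightarrow> 'i set \<Rightarrow> ('i \<Rightarrow> 'a) \<Rightarrow> ('i \<Rightarrow> 'a \<Rightarrow> real) \<Rightarrow> bool" where
  "biorthogonal_system Y \<Gamma> y f \<longleftrightarrow>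
     (\<forall>\<gamma>\<in>\<Gamma>. y \<gamma> \<in> Y \<and> f \<gamma> \<in> dual_on Y) \<and>
     (\<forall>\<alpha>\<in>\<Gamma>. \<forall>\<beta>\<in>\<Gamma>. f \<alpha> (y \<beta>) = (if \<alpha> = \<beta> then 1 else 0))"

(* On real-valued functionals the strong operator topology, i.e. the topology of pointwise
   convergence, is the weak* topology. *)
abbreviation weak_star_topology :: "('a::real_normed_vector \<Rightarrow>\<^sub>L real) topology" where
  "weak_star_topology \<equiv> strong_operator_topology"

definition M_basis ::
  "'i set \<Rightarrow> ('i \<Rightarrow> 'a::banach) \<Rightarrow> ('i \<Rightarrow> 'a \<Rightarrow>\<^sub>L real) \<Rightarrow> bool" where
  "M_basis \<Gamma> x f \<longleftrightarrow>
     biorthogonal_system UNIV \<Gamma> x (\<lambda>\<gamma>. blinfun_apply (f \<gamma>)) \<and>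
     closure (span (x ` \<Gamma>)) = UNIV \<and>
     weak_star_topology closure_of span (f ` \<Gamma>) = UNIV"

(* The members of a biorthogonal system are pairwise distinct, so in the next two definitions
   index sets inside the space itself suffice; the lemmas after them allow any index type. *)
definition weakly_Lindelof_determined :: "'a::banach itself \<Rightarrow> bool" where
  "weakly_Lindelof_determined _ \<longleftrightarrow>
     (\<exists>(\<Gamma> :: 'a set) x f. M_basis \<Gamma> x f \<and>
        (\<forall>\<phi> :: 'a \<Rightarrow>\<^sub>L real. countable {\<gamma>\<in>\<Gamma>. blinfun_apply \<phi> (x \<gamma>) \<noteq> 0}))"

definition has_uncountable_biorthogonal_system :: "'a::real_normed_vector set \<Rightarrow> bool" where
  "has_uncountable_biorthogonal_system Y \<longleftrightarrow>
     (\<exists>(\<Gamma> :: 'a set) y f. biorthogonal_system Y \<Gamma> y f \<and> uncountable \<Gamma>)"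

lemma biorthogonal_system_inj_on:
  assumes "biorthogonal_system Y \<Gamma> y f"
  shows "inj_on y \<Gamma>"
proof (rule inj_onI)
  fix a b assume *: "a \<in> \<Gamma>" "b \<in> \<Gamma>" "y a = y b"
  have "f a (y a) = 1" "f a (y b) = (if a = b then 1 else 0)"
    using assms *(1,2) unfolding biorthogonal_system_def by simp_all
  with *(3) show "a = b" by (metis zero_neq_one)
qed

lemma biorthogonal_system_reindex:
  assumes "biorthogonal_system Y \<Gamma> y f" and g: "\<And>\<gamma>. \<gamma> \<in> \<Gamma> \<Longrightarrow> g (y \<gamma>) = \<gamma>"
  shows "biorthogonal_system Y (y ` \<Gamma>) id (f \<circ> g)"
  using assms biorthogonal_system_inj_on[OF assms(1)]
  unfolding biorthogonal_system_def by (auto simp: inj_on_def)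

lemma has_uncountable_biorthogonal_systemI:
  fixes \<Gamma> :: "'i set"
  assumes "biorthogonal_system Y \<Gamma> y f" and "uncountable \<Gamma>"
  shows "has_uncountable_biorthogonal_system Y"
proof -
  note inj = biorthogonal_system_inj_on[OF assms(1)]
  have "biorthogonal_system Y (y ` \<Gamma>) id (f \<circ> inv_into \<Gamma> y)"
    using assms(1) by (rule biorthogonal_system_reindex) (simp add: inj)
  moreover have "uncountable (y ` \<Gamma>)"
    using assms(2) inj by (simp add: countable_image_inj_eq)
  ultimately show ?thesis
    unfolding has_uncountable_biorthogonal_system_def by blast
qed

lemma weakly_Lindelof_determinedI:
  fixes \<Gamma> :: "'i set" and x :: "'i \<Rightarrow> 'a::banach"
  assumes "M_basis \<Gamma> x f"
    and "\<And>\<phi> :: 'a \<Rightarrow>\<^sub>L real. countable {\<gamma>\<in>\<Gamma>. blinfun_apply \<phi> (x \<gamma>) \<noteq> 0}"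
  shows "weakly_Lindelof_determined TYPE('a)"
proof -
  let ?g = "inv_into \<Gamma> x"
  have bio: "biorthogonal_system UNIV \<Gamma> x (\<lambda>\<gamma>. blinfun_apply (f \<gamma>))"
    using assms(1) by (simp add: M_basis_def)
  note inj = biorthogonal_system_inj_on[OF bio]
  have "biorthogonal_system UNIV (x ` \<Gamma>) id ((\<lambda>\<gamma>. blinfun_apply (f \<gamma>)) \<circ> ?g)"
    using bio by (rule biorthogonal_system_reindex) (simp add: inj)
  moreover have "(f \<circ> ?g) ` (x ` \<Gamma>) = f ` \<Gamma>"
    using inj by (force simp: image_image)
  ultimately have "M_basis (x ` \<Gamma>) id (f \<circ> ?g)"
    using assms(1) by (simp add: M_basis_def o_def)
  moreover have "countable {\<gamma> \<in> x ` \<Gamma>. blinfun_apply \<phi> (id \<gamma>) \<noteq> 0}" for \<phi> :: "'a \<Rightarrow>\<^sub>L real"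
  proof -
    have "{\<gamma> \<in> x ` \<Gamma>. blinfun_apply \<phi> (id \<gamma>) \<noteq> 0} = x ` {\<gamma>\<in>\<Gamma>. blinfun_apply \<phi> (x \<gamma>) \<noteq> 0}"
      by auto
    then show ?thesis using assms(2)[of \<phi>] by simp
  qed
  ultimately show ?thesis
    unfolding weakly_Lindelof_determined_def by blast
qed

end

theory Submission
  imports Defs
begin

text \<open>
  WLD enters only through cardinality: a functional is determined by its countably many nonzero
  values on the M-basis, so under CH both $X$ and $X^*$ have at most $\omega_1$ elements. Enumerate
  $X^*$ as $(g_\alpha)_{\alpha<\omega_1}$. By Baire, choose $u_\alpha$ recursively, each in a
  prescribed ball so that the $u_\alpha$ are dense, off the kernels of countably many nonzero
  functionals: one for each pair of finite sets $F \subseteq \{g_\beta\}_{\beta<\alpha}$ and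
  $S \subseteq \{u_\beta\}_{\beta<\alpha}$ such that some nonzero member of span $F$ kills $S$.
  Put $Y$ = span of the $u_\alpha$.

  Given an uncountable biorthogonal system in $Y$, uncountably many of its vectors are combinations
  of the same minimal number $n$ of the $u_\alpha$. Let $F$ consist of $n+1$ of its functionals. Some
  other such vector $y$ involves an index beyond those of $F$; let $\alpha$ be its largest index
  and $S$ the $n-1$ remaining $u$'s. By a dimension count a nonzero member of span $F$ kills $S$, so
  some member of span $F$ kills $S$ but not $u_\alpha$. It also kills $y$, so the coefficient of
  $u_\alpha$ in $y$ is $0$, against the minimality of $n$.
\<close>

section \<open>Cardinality under the Continuum Hypothesis\<close>

text \<open>The cardinal order of the reals is an initial ordinal, under CH \<omega>_1, so its
  proper initial segments are countable. Its strict part makes \<open>real\<close> an index type for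
  transfinite recursion of length \<omega>_1.\<close>

lemma continuum_hypothesis_wellorder:
  assumes "continuum_hypothesis"
  obtains r :: "real rel" where "wf r" "trans r" "total r" "\<And>x. countable {y. (y, x) \<in> r}"
proof
  let ?c = "|UNIV :: real set|"
  have wo: "well_order_on UNIV ?c"
    by (rule card_of_well_order_on)
  then have lin: "linear_order_on UNIV ?c" and "wf (?c - Id)"
    by (auto simp: well_order_on_def)
  then show "wf (?c - Id)" "trans (?c - Id)" "total (?c - Id)"
    by (auto simp: linear_order_on_def partial_order_on_def preorder_on_def
        intro: trans_diff_Id)
  fix x
  have "|underS ?c x| <o ?c"
    by (rule card_of_underS) (simp_all add: card_of_card_order_on Field_card_of)
  then have "|underS ?c x| <o cardSuc natLeq"
    using assms ordLess_ordIso_trans unfolding continuum_hypothesis_def by blast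
  then have "|underS ?c x| \<le>o natLeq"
    using cardSuc_ordLeq_ordLess[OF natLeq_Card_order card_of_Card_order] by blast
  then have "countable (underS ?c x)"
    by (metis card_of_nat card_of_ordLeq countable_def ordIso_symmetric ordLeq_ordIso_trans)
  moreover have "{y. (y, x) \<in> ?c - Id} = underS ?c x"
    by (auto simp: underS_def)
  ultimately show "countable {y. (y, x) \<in> ?c - Id}"
    by simp
qed

text \<open>A real amounts to a set of naturals, and a sequence of such sets to one set of pairs,
  hence again to a single real.\<close>

lemma inj_real_sequences:
  obtains j :: "(nat \<Rightarrow> real) \<Rightarrow> real" where "\<And>s t n. j s = j t \<Longrightarrow> s n = t n"
proof -
  obtain h :: "real \<Rightarrow> nat set" where h: "bij h"
    using nat_sets_eqpoll_reals eqpoll_sym unfolding eqpoll_def by blast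
  define p where "p s = inv h (prod_encode ` (SIGMA n:UNIV. h (s n)))" for s :: "nat \<Rightarrow> real"
  show thesis
  proof
    fix s t n assume "p s = p t"
    then have "prod_encode ` (SIGMA n:UNIV. h (s n)) = prod_encode ` (SIGMA n:UNIV. h (t n))"
      using h by (metis p_def bij_inv_eq_iff)
    then have "(SIGMA n:UNIV. h (s n)) = (SIGMA n:UNIV. h (t n))"
      by (meson inj_image_eq_iff inj_prod_encode)
    then have "h (s n) = h (t n)"
      by blast
    then show "s n = t n"
      using h by (meson bij_is_inj injD)
  qed
qed

text \<open>A point is recovered from any sequence in \<open>D\<close> converging to it, and real
  sequences are coded by single reals.\<close>

lemma inj_into_real_of_dense:
  fixes D :: "'a::metric_space set" and i :: "'a \<Rightarrow> real"
  assumes "closure D = UNIV" and "inj_on i D"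
  obtains k :: "'a \<Rightarrow> real" where "inj k"
proof -
  have "\<forall>x. \<exists>s :: nat \<Rightarrow> 'a. (\<forall>n. s n \<in> D) \<and> s \<longlonglongrightarrow> x"
    using assms(1) closure_sequential by blast
  then obtain s :: "'a \<Rightarrow> nat \<Rightarrow> 'a" where s: "\<And>x n. s x n \<in> D" "\<And>x. s x \<longlonglongrightarrow> x"
    by metis
  obtain j :: "(nat \<Rightarrow> real) \<Rightarrow> real" where j: "\<And>s t n. j s = j t \<Longrightarrow> s n = t n"
    by (rule inj_real_sequences) blast
  have "inj (\<lambda>x. j (\<lambda>n. i (s x n)))"
  proof (rule injI)
    fix x y assume "j (\<lambda>n. i (s x n)) = j (\<lambda>n. i (s y n))"
    then have "i (s x n) = i (s y n)" for n
      by (rule j)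
    then have "s x = s y"
      using assms(2) s(1) by (meson inj_onD ext)
    then show "x = y"
      using s(2) LIMSEQ_unique by metis
  qed
  then show thesis ..
qed

lemma blinfun_eq_on_dense_span:
  fixes \<phi> \<psi> :: "'a::real_normed_vector \<Rightarrow>\<^sub>L real"
  assumes "closure (span A) = UNIV" and "\<And>a. a \<in> A \<Longrightarrow> \<phi> a = \<psi> a"
  shows "\<phi> = \<psi>"
proof (rule blinfun_eqI)
  fix v
  have "span A \<subseteq> {v. \<phi> v = \<psi> v}"
    using assms(2) by (intro span_minimal) (auto simp: subspace_def blinfun.bilinear_simps)
  moreover have "closed {v. \<phi> v = \<psi> v}"
    by (intro closed_Collect_eq continuous_intros)
  ultimately have "closure (span A) \<subseteq> {v. \<phi> v = \<psi> v}"
    by (rule closure_minimal)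
  then show "\<phi> v = \<psi> v"
    using assms(1) by auto
qed

text \<open>A functional is determined by an enumeration of its countable support in \<Gamma> and
  its values there. Both fit into one real sequence: codes of support points at even positions,
  values at odd ones.\<close>

lemma inj_dual_into_real:
  fixes x :: "'i \<Rightarrow> 'a::real_normed_vector" and k :: "'i \<Rightarrow> real"
  assumes "inj k" and "closure (span (x ` \<Gamma>)) = UNIV"
    and supp: "\<And>\<phi> :: 'a \<Rightarrow>\<^sub>L real. countable {\<gamma>\<in>\<Gamma>. \<phi> (x \<gamma>) \<noteq> 0}"
  obtains l :: "('a \<Rightarrow>\<^sub>L real) \<Rightarrow> real" where "inj l"
proof -
  obtain j :: "(nat \<Rightarrow> real) \<Rightarrow> real" where j: "\<And>s t n. j s = j t \<Longrightarrow> s n = t n"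
    by (rule inj_real_sequences) blast
  \<comment> \<open>A finite support is padded with a default value; what matters is that every
    support point occurs.\<close>
  define c where "c \<phi> = from_nat_into {\<gamma>\<in>\<Gamma>. blinfun_apply \<phi> (x \<gamma>) \<noteq> 0}" for \<phi> :: "'a \<Rightarrow>\<^sub>L real"
  have c: "\<exists>n. c \<phi> n = \<gamma>" if "\<gamma> \<in> \<Gamma>" "\<phi> (x \<gamma>) \<noteq> 0" for \<phi> :: "'a \<Rightarrow>\<^sub>L real" and \<gamma>
    unfolding c_def using that by (intro from_nat_into_surj supp) auto
  define l where
    "l \<phi> = j (\<lambda>n. if even n then k (c \<phi> (n div 2)) else \<phi> (x (c \<phi> (n div 2))))"
    for \<phi> :: "'a \<Rightarrow>\<^sub>L real"
  have "inj l"
  proof (rule injI)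
    fix \<phi> \<psi> assume "l \<phi> = l \<psi>"
    then have *: "(if even n then k (c \<phi> (n div 2)) else \<phi> (x (c \<phi> (n div 2)))) =
        (if even n then k (c \<psi> (n div 2)) else \<psi> (x (c \<psi> (n div 2))))" for n
      unfolding l_def by (rule j)
    have "c \<phi> n = c \<psi> n" for n
      using *[of "2 * n"] \<open>inj k\<close> by (simp add: inj_eq)
    moreover have "\<phi> (x (c \<phi> n)) = \<psi> (x (c \<psi> n))" for n
      using *[of "2 * n + 1"] by simp
    \<comment> \<open>A point of either support occurs in the common enumeration, with equal values;
      elsewhere in \<Gamma> both values are 0.\<close>
    ultimately have "\<phi> (x \<gamma>) = \<psi> (x \<gamma>)" if "\<gamma> \<in> \<Gamma>" for \<gamma>
      using c[OF that, of \<phi>] c[OF that, of \<psi>] by metis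
    then show "\<phi> = \<psi>"
      using assms(2) by (intro blinfun_eq_on_dense_span) auto
  qed
  then show thesis ..
qed

section \<open>Homogeneous linear systems\<close>

text \<open>Gaussian elimination by induction on the equations \<open>W\<close>: a pivot
  \<open>b\<close> removes one equation and one unknown, so the surplus of unknowns
  persists.\<close>

lemma homogeneous_system_nontrivial_solution:
  fixes M :: "'i \<Rightarrow> 'w \<Rightarrow> 'b::field"
  assumes "finite W" "finite A" "card W < card A"
  obtains c where "\<exists>a\<in>A. c a \<noteq> 0" "\<And>w. w \<in> W \<Longrightarrow> (\<Sum>a\<in>A. c a * M a w) = 0"
  using assms
proof (induction W arbitrary: A M thesis rule: finite_induct)
  case empty
  then show ?case
    by (auto intro!: empty(1)[of "\<lambda>_. 1"] simp: card_gt_0_iff)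
next
  case (insert w W)
  show ?case
  proof (cases "\<forall>a\<in>A. M a w = 0")
    case True
    obtain c where "\<exists>a\<in>A. c a \<noteq> 0" "\<And>w. w \<in> W \<Longrightarrow> (\<Sum>a\<in>A. c a * M a w) = 0"
      using insert by (metis card_insert_disjoint Suc_lessD)
    with True show ?thesis
      by (intro insert.prems(1)[of c]) auto
  next
    case False
    then obtain b where b: "b \<in> A" "M b w \<noteq> 0" by auto
    have "finite (A - {b})" "card W < card (A - {b})"
      using insert b by auto
    then obtain c where c: "\<exists>a\<in>A - {b}. c a \<noteq> 0"
      "\<And>v. v \<in> W \<Longrightarrow> (\<Sum>a\<in>A - {b}. c a * (M a v - M a w / M b w * M b v)) = 0"
      by (rule insert.IH[where A = "A - {b}" and M = "\<lambda>a v. M a v - M a w / M b w * M b v",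
            rotated]) blast
    \<comment> \<open>The value at \<open>b\<close> is dictated by equation \<open>w\<close>, solved
      for the pivot unknown.\<close>
    define s where "s = (\<Sum>a\<in>A - {b}. c a * (M a w / M b w))"
    define d where "d = c(b := - s)"
    have "(\<Sum>a\<in>A. d a * M a v) = (\<Sum>a\<in>A - {b}. c a * (M a v - M a w / M b w * M b v))" for v
    proof -
      have "(\<Sum>a\<in>A. d a * M a v) = d b * M b v + (\<Sum>a\<in>A - {b}. d a * M a v)"
        using insert.prems(2) b(1) by (rule sum.remove)
      also have "\<dots> = (\<Sum>a\<in>A - {b}. c a * M a v) - s * M b v"
        by (simp add: d_def)
      also have "\<dots> = (\<Sum>a\<in>A - {b}. c a * (M a v - M a w / M b w * M b v))"
        by (simp add: s_def sum_distrib_right right_diff_distrib sum_subtractf mult.assoc)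
      finally show ?thesis .
    qed
    moreover have "(\<Sum>a\<in>A - {b}. c a * (M a w - M a w / M b w * M b w)) = 0"
      using b(2) by simp
    ultimately have "(\<Sum>a\<in>A. d a * M a v) = 0" if "v \<in> insert w W" for v
      using that c(2) by (metis insertE)
    moreover have "\<exists>a\<in>A. d a \<noteq> 0"
      using c(1) by (auto simp: d_def)
    ultimately show ?thesis
      using insert.prems(1) by blast
  qed
qed

section \<open>Baire category and generic families\<close>

text \<open>A zero of \<phi> is the limit of its translates by small multiples of a vector off the
  kernel.\<close>

lemma dense_nonzero_blinfun:
  fixes \<phi> :: "'a::real_normed_vector \<Rightarrow>\<^sub>L real"
  assumes "\<phi> \<noteq> 0"
  shows "closure {v. \<phi> v \<noteq> 0} = UNIV"
proof -
  obtain w where w: "\<phi> w \<noteq> 0"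
    using assms by (metis blinfun_eqI zero_blinfun.rep_eq)
  have "v \<in> closure {v. \<phi> v \<noteq> 0}" for v
  proof (cases "\<phi> v = 0")
    case True
    have "(\<lambda>n. v + (1 / real (Suc n)) *\<^sub>R w) \<longlonglongrightarrow> v + 0 *\<^sub>R w"
      by (intro tendsto_intros LIMSEQ_Suc lim_1_over_n)
    moreover have "\<phi> (v + (1 / real (Suc n)) *\<^sub>R w) \<noteq> 0" for n
      using True w by (simp add: blinfun.bilinear_simps)
    ultimately show ?thesis
      unfolding closure_sequential by (intro exI[of _ "\<lambda>n. v + (1 / real (Suc n)) *\<^sub>R w"]) auto
  next
    case False
    then show ?thesis using closure_subset[of "{v. \<phi> v \<noteq> 0}"] by auto
  qed
  then show ?thesis by auto
qed

text \<open>The complements of the kernels are open and dense, so by Baire their countable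
  intersection meets every nonempty open set.\<close>

lemma avoid_countably_many_kernels:
  fixes B :: "'a::banach set" and \<Phi> :: "('a \<Rightarrow>\<^sub>L real) set"
  assumes "countable \<Phi>" "0 \<notin> \<Phi>" "open B" "B \<noteq> {}"
  obtains v where "v \<in> B" "\<And>\<phi>. \<phi> \<in> \<Phi> \<Longrightarrow> \<phi> v \<noteq> 0"
proof -
  let ?G = "(\<lambda>\<phi>. {v. blinfun_apply \<phi> v \<noteq> 0}) ` \<Phi>"
  have "Met_TC.mtopology closure_of \<Inter>?G = (UNIV :: 'a set)"
  proof (rule Met_TC.metric_Baire_category)
    show "Met_TC.mcomplete TYPE('a)"
      by (simp add: mcomplete_iff_complete complete_UNIV)
    show "countable ?G"
      using assms(1) by simp
    fix T assume "T \<in> ?G"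
    then obtain \<phi> where \<phi>: "\<phi> \<in> \<Phi>" "T = {v. blinfun_apply \<phi> v \<noteq> 0}" by auto
    then have "\<phi> \<noteq> 0" using assms(2) by auto
    moreover have "open T"
      unfolding \<phi>(2) by (intro open_Collect_neq continuous_intros)
    ultimately show "openin Met_TC.mtopology T \<and> Met_TC.mtopology closure_of T = UNIV"
      using dense_nonzero_blinfun \<phi>(2) by simp
  qed
  then have "closure (\<Inter>?G) = UNIV" by simp
  then have "B \<inter> \<Inter>?G \<noteq> {}"
    using assms(3,4) open_Int_closure_eq_empty[of B "\<Inter>?G"] by auto
  then show thesis
    using that by blast
qed

text \<open>Only one functional per pair of \<open>S\<close> and \<open>F\<close> has to be nonzero
  at \<open>u a\<close>: the annihilator of \<open>S\<close> in the span of \<open>F\<close> may be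
  uncountable, while Baire category avoids only countably many kernels. Restricting both finite sets
  to indices below \<open>a\<close> keeps the pairs countable in number.\<close>

definition generic_family ::
  "'i rel \<Rightarrow> ('i \<Rightarrow> 'a::real_normed_vector \<Rightarrow>\<^sub>L real) \<Rightarrow> ('i \<Rightarrow> 'a) \<Rightarrow> bool" where
  "generic_family r g u \<longleftrightarrow>
     (\<forall>a S F. finite S \<and> finite F \<and> S \<subseteq> {b. (b, a) \<in> r} \<and> F \<subseteq> g ` {b. (b, a) \<in> r} \<and>
        (\<exists>\<phi>\<in>span F. \<phi> \<noteq> 0 \<and> (\<forall>s\<in>S. blinfun_apply \<phi> (u s) = 0)) \<longrightarrow>
        (\<exists>\<phi>\<in>span F. blinfun_apply \<phi> (u a) \<noteq> 0 \<and> (\<forall>s\<in>S. \<phi> (u s) = 0)))"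

lemma generic_familyD:
  assumes "generic_family r g u" "finite S" "finite F"
    and "S \<subseteq> {b. (b, a) \<in> r}" "F \<subseteq> g ` {b. (b, a) \<in> r}"
    and "\<phi> \<in> span F" "\<phi> \<noteq> 0" "\<forall>s\<in>S. blinfun_apply \<phi> (u s) = 0"
  obtains \<theta> where "\<theta> \<in> span F" "blinfun_apply \<theta> (u a) \<noteq> 0" "\<And>s. s \<in> S \<Longrightarrow> blinfun_apply \<theta> (u s) = 0"
proof -
  have "\<exists>\<phi>\<in>span F. \<phi> \<noteq> 0 \<and> (\<forall>s\<in>S. blinfun_apply \<phi> (u s) = 0)"
    using assms(6-8) by auto
  with assms(1-5) have "\<exists>\<theta>\<in>span F. blinfun_apply \<theta> (u a) \<noteq> 0 \<and> (\<forall>s\<in>S. blinfun_apply \<theta> (u s) = 0)"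
    unfolding generic_family_def by simp
  then show thesis
    using that by auto
qed

text \<open>Well-founded recursion along \<open>r\<close>: at stage \<open>a\<close> there are
  countably many pairs of finite sets, and each with a nonzero annihilator contributes one kernel to
  avoid. The sets \<open>B a\<close> leave room to make the family dense.\<close>

lemma generic_family_exists:
  fixes B :: "'i \<Rightarrow> 'a::banach set"
  assumes "wf r" and ctb: "\<And>a. countable {b. (b, a) \<in> r}"
    and B: "\<And>a. open (B a)" "\<And>a. B a \<noteq> {}"
  obtains u where "generic_family r g u" "\<And>a. u a \<in> B a"
proof -
  define K where "K u F S = {\<phi>\<in>span F. \<phi> \<noteq> 0 \<and> (\<forall>s\<in>S. blinfun_apply \<phi> (u s) = 0)}"
    for u :: "'i \<Rightarrow> 'a" and F :: "('a \<Rightarrow>\<^sub>L real) set" and S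
  define P where "P u a v \<longleftrightarrow> v \<in> B a \<and>
     (\<forall>S F. finite S \<and> finite F \<and> S \<subseteq> {b. (b, a) \<in> r} \<and> F \<subseteq> g ` {b. (b, a) \<in> r} \<and> K u F S \<noteq> {} \<longrightarrow>
        (\<exists>\<phi>\<in>K u F S. blinfun_apply \<phi> v \<noteq> 0))" for u a v
  have "\<exists>u. \<forall>a. P u a (u a)"
  proof (rule dependent_wf_choice[OF \<open>wf r\<close>])
    fix f h :: "'i \<Rightarrow> 'a" and a v
    assume "\<And>z. (z, a) \<in> r \<Longrightarrow> f z = h z"
    \<comment> \<open>The condition at \<open>a\<close> consults \<open>u\<close> only through
      \<open>K u F S\<close> with \<open>S\<close> below \<open>a\<close>, hence depends on earlier
      choices alone.\<close>
    then have "K f F S = K h F S" if "S \<subseteq> {b. (b, a) \<in> r}" for F S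
      using that by (auto simp: K_def subset_iff)
    then show "P f a v = P h a v"
      unfolding P_def by (metis (no_types, lifting))
  next
    fix a and u :: "'i \<Rightarrow> 'a"
    let ?I = "{F. finite F \<and> F \<subseteq> g ` {b. (b, a) \<in> r}} \<times> {S. finite S \<and> S \<subseteq> {b. (b, a) \<in> r}}"
    define I where "I = {(F, S)\<in>?I. K u F S \<noteq> {}}"
    \<comment> \<open>One representative per pair gives a countable set of functionals, although
      \<open>K u F S\<close> may be uncountable.\<close>
    define \<phi> where "\<phi> p = (SOME \<phi>. \<phi> \<in> K u (fst p) (snd p))" for p
    have \<phi>: "\<phi> (F, S) \<in> K u F S" if "K u F S \<noteq> {}" for F S
      using that by (simp add: \<phi>_def some_in_eq)
    have \<phi>_nz: "\<phi> p \<noteq> 0" if "p \<in> I" for p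
    proof -
      obtain F S where p: "p = (F, S)" by (cases p)
      have "\<phi> (F, S) \<in> K u F S"
        using that by (intro \<phi>) (simp add: I_def p)
      then show ?thesis by (simp add: K_def p)
    qed
    have "countable ?I"
      using ctb by (intro countable_SIGMA countable_Collect_finite_subset countable_image)
    then have "countable (\<phi> ` I)"
      by (auto simp: I_def intro!: countable_image elim: countable_subset[rotated])
    moreover have "0 \<notin> \<phi> ` I"
      using \<phi>_nz by force
    ultimately obtain v where v: "v \<in> B a" "\<And>\<psi>. \<psi> \<in> \<phi> ` I \<Longrightarrow> \<psi> v \<noteq> 0"
      using avoid_countably_many_kernels B by metis
    have "P u a v"
      unfolding P_def
    proof (intro conjI allI impI v(1))
      fix S F
      assume *: "finite S \<and> finite F \<and> S \<subseteq> {b. (b, a) \<in> r} \<and> F \<subseteq> g ` {b. (b, a) \<in> r} \<and> K u F S \<noteq> {}"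
      then have "(F, S) \<in> I" by (auto simp: I_def)
      then show "\<exists>\<phi>\<in>K u F S. \<phi> v \<noteq> 0"
        using \<phi> v(2) * by blast
    qed
    then show "\<exists>v. P u a v" ..
  qed
  then obtain u where u: "\<And>a. P u a (u a)" by blast
  show thesis
  proof
    show "u a \<in> B a" for a
      using u by (simp add: P_def)
    show "generic_family r g u"
      unfolding generic_family_def
    proof (intro allI impI)
      fix a S F
      assume *: "finite S \<and> finite F \<and> S \<subseteq> {b. (b, a) \<in> r} \<and> F \<subseteq> g ` {b. (b, a) \<in> r} \<and>
        (\<exists>\<phi>\<in>span F. \<phi> \<noteq> 0 \<and> (\<forall>s\<in>S. blinfun_apply \<phi> (u s) = 0))"
      then have "K u F S \<noteq> {}" by (auto simp: K_def)
      with * u[of a] have "\<exists>\<phi>\<in>K u F S. \<phi> (u a) \<noteq> 0"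
        unfolding P_def by blast
      then show "\<exists>\<phi>\<in>span F. \<phi> (u a) \<noteq> 0 \<and> (\<forall>s\<in>S. \<phi> (u s) = 0)"
        by (auto simp: K_def)
    qed
  qed
qed

section \<open>Extension of functionals and countable spans\<close>

text \<open>A bounded functional on \<open>Y\<close> is Lipschitz and so extends continuously to the
  closure; linearity and the bound define closed conditions and pass from \<open>Y\<close> to the
  whole space. This turns the functionals of a biorthogonal system in \<open>Y\<close> into members
  of X*.\<close>

lemma dual_on_dense_extension:
  fixes Y :: "'a::real_normed_vector set"
  assumes "subspace Y" "closure Y = UNIV" "f \<in> dual_on Y"
  obtains \<phi> :: "'a \<Rightarrow>\<^sub>L real" where "\<And>y. y \<in> Y \<Longrightarrow> \<phi> y = f y"
proof -
  from assms(3) obtain K where add: "\<And>x y. x \<in> Y \<Longrightarrow> y \<in> Y \<Longrightarrow> f (x + y) = f x + f y"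
    and scale: "\<And>c x. x \<in> Y \<Longrightarrow> f (c *\<^sub>R x) = c * f x"
    and K: "\<And>x. x \<in> Y \<Longrightarrow> \<bar>f x\<bar> \<le> K * norm x"
    unfolding dual_on_def by blast
  have diff: "f (x - y) = f x - f y" if "x \<in> Y" "y \<in> Y" for x y
    using add[of x "(-1) *\<^sub>R y"] scale[of y "-1"] that assms(1) subspace_scale[of Y y "-1"] by simp
  \<comment> \<open>A Lipschitz constant must be nonnegative, which \<open>K\<close> is not assumed
    to be.\<close>
  have "\<bar>K\<bar>-lipschitz_on Y f"
  proof (rule lipschitz_onI)
    fix x y assume xy: "x \<in> Y" "y \<in> Y"
    then have "x - y \<in> Y" using assms(1) subspace_diff by blast
    then have "\<bar>f x - f y\<bar> \<le> K * norm (x - y)"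
      using K[of "x - y"] diff[OF xy] by simp
    also have "\<dots> \<le> \<bar>K\<bar> * norm (x - y)"
      by (simp add: mult_right_mono)
    finally show "dist (f x) (f y) \<le> \<bar>K\<bar> * dist x y"
      by (simp add: dist_norm)
  qed simp
  then have "uniformly_continuous_on Y f"
    by (rule lipschitz_on_uniformly_continuous)
  then obtain h where h: "uniformly_continuous_on (closure Y) h" "\<And>x. x \<in> Y \<Longrightarrow> f x = h x"
    by (rule uniformly_continuous_on_extension_on_closure) blast
  then have cont: "continuous_on UNIV h"
    using assms(2) uniformly_continuous_imp_continuous by fastforce
  have [continuous_intros]: "continuous_on UNIV (\<lambda>x. h (t x))"
    if "continuous_on UNIV t" for t :: "'a \<Rightarrow> 'a"
    using continuous_on_compose2[OF cont that] by simp
  have dense: "Q x" if "closed {x. Q x}" "\<And>x. x \<in> Y \<Longrightarrow> Q x" for Q x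
    using closure_minimal[of Y "{x. Q x}"] that assms(2) by auto
  have Y_add: "h (x + y) = h x + h y" if "x \<in> Y" "y \<in> Y" for x y
    using that add h(2) assms(1) subspace_add by metis
  \<comment> \<open>Additivity is extended in one variable at a time: first in \<open>x\<close> with
    \<open>y\<close> fixed in \<open>Y\<close>, then in \<open>y\<close>.\<close>
  have h_add': "h (x + y) = h x + h y" if "y \<in> Y" for x y
  proof (rule dense[where Q = "\<lambda>x. h (x + y) = h x + h y"])
    show "h (x + y) = h x + h y" if "x \<in> Y" for x
      using that \<open>y \<in> Y\<close> by (rule Y_add)
  qed (intro closed_Collect_eq continuous_intros)
  have h_add: "h (x + y) = h x + h y" for x y
  proof (rule dense[where Q = "\<lambda>y. h (x + y) = h x + h y"])
    show "h (x + y) = h x + h y" if "y \<in> Y" for y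
      using that by (rule h_add')
  qed (intro closed_Collect_eq continuous_intros)
  have h_scale: "h (c *\<^sub>R x) = c * h x" for c x
  proof (rule dense[where Q = "\<lambda>x. h (c *\<^sub>R x) = c * h x"])
    show "h (c *\<^sub>R x) = c * h x" if "x \<in> Y" for x
      using that scale h(2) assms(1) subspace_scale by metis
  qed (intro closed_Collect_eq continuous_intros)
  have "\<bar>h x\<bar> \<le> K * norm x" for x
  proof (rule dense[where Q = "\<lambda>x. \<bar>h x\<bar> \<le> K * norm x"])
    show "\<bar>h x\<bar> \<le> K * norm x" if "x \<in> Y" for x
      using that K h(2) by metis
  qed (intro closed_Collect_le continuous_intros)
  then have "bounded_linear h"
    by (intro bounded_linear_intro[of h K]) (auto simp: h_add h_scale mult.commute)
  then show thesis
    using that[of "Blinfun h"] h(2) by (simp add: bounded_linear_Blinfun_apply)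
qed

lemma in_span_finite_subset:
  fixes v :: "'a::real_vector"
  assumes "v \<in> span C"
  obtains T where "finite T" "T \<subseteq> C" "v \<in> span T"
proof -
  obtain T c where T: "finite T" "T \<subseteq> C" "v = (\<Sum>a\<in>T. c a *\<^sub>R a)"
    using assms unfolding span_explicit by blast
  then have "v \<in> span T"
    by (auto intro: span_sum span_scale span_base)
  with T that show thesis by blast
qed

text \<open>A countable set has countably many finite subsets, and the finite-dimensional span of
  each holds only finitely many members of an independent set.\<close>

lemma countable_independent_in_countable_span:
  fixes A :: "'a::real_vector set"
  assumes "independent A" "A \<subseteq> span C" "countable C"
  shows "countable A"
proof -
  have "A \<subseteq> (\<Union>T\<in>{T. finite T \<and> T \<subseteq> C}. A \<inter> span T)"
  proof
    fix a assume "a \<in> A"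
    then have "a \<in> span C" using assms(2) by auto
    then obtain T where "finite T" "T \<subseteq> C" "a \<in> span T"
      using in_span_finite_subset by metis
    then show "a \<in> (\<Union>T\<in>{T. finite T \<and> T \<subseteq> C}. A \<inter> span T)"
      using \<open>a \<in> A\<close> by auto
  qed
  moreover have "countable (A \<inter> span T)" if "finite T" for T
  proof -
    have "independent (A \<inter> span T)"
      using assms(1) by (rule independent_mono) auto
    then show ?thesis
      using independent_span_bound[OF that] by (auto intro: countable_finite)
  qed
  then have "countable (\<Union>T\<in>{T. finite T \<and> T \<subseteq> C}. A \<inter> span T)"
    using countable_Collect_finite_subset[OF assms(3)] by (intro countable_UN) auto
  ultimately show ?thesis
    by (rule countable_subset)
qed

section \<open>Spans of generic families\<close>

text \<open>Density extends the functionals of a system to the whole space, and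
  \<open>surj g\<close> gives each a position in the enumeration. As initial segments are countable,
  some vector involves an index above any finitely many of these positions, where genericity
  applies.\<close>

lemma generic_family_span_no_uncountable_biorthogonal_system:
  fixes u :: "'i \<Rightarrow> 'a::real_normed_vector"
  assumes r: "wf r" "trans r" "total r" and ctb: "\<And>a. countable {b. (b, a) \<in> r}"
    and g: "surj g" and u: "generic_family r g u"
    and dense: "closure (span (range u)) = UNIV"
  shows "\<not> has_uncountable_biorthogonal_system (span (range u))"
proof
  assume "has_uncountable_biorthogonal_system (span (range u))"
  then obtain \<Gamma> :: "'a set" and y f where bio: "biorthogonal_system (span (range u)) \<Gamma> y f"
    and unc: "uncountable \<Gamma>"
    unfolding has_uncountable_biorthogonal_system_def by blast
  have y: "y \<gamma> \<in> span (range u)" "f \<gamma> \<in> dual_on (span (range u))" if "\<gamma> \<in> \<Gamma>" for \<gamma>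
    using bio that unfolding biorthogonal_system_def by auto
  have "\<exists>\<phi> :: 'a \<Rightarrow>\<^sub>L real. \<forall>v\<in>span (range u). \<phi> v = f \<gamma> v" if "\<gamma> \<in> \<Gamma>" for \<gamma>
    using dual_on_dense_extension[OF subspace_span dense y(2)[OF that]] by metis
  then obtain \<phi> :: "'a \<Rightarrow> 'a \<Rightarrow>\<^sub>L real"
    where "\<And>\<gamma> v. \<gamma> \<in> \<Gamma> \<Longrightarrow> v \<in> span (range u) \<Longrightarrow> \<phi> \<gamma> v = f \<gamma> v"
    by metis
  then have \<phi>: "\<phi> \<alpha> (y \<beta>) = (if \<alpha> = \<beta> then 1 else 0)" if "\<alpha> \<in> \<Gamma>" "\<beta> \<in> \<Gamma>" for \<alpha> \<beta>
    using bio that unfolding biorthogonal_system_def by auto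
  have ex: "\<exists>T. finite T \<and> y \<gamma> \<in> span (u ` T)" if \<gamma>: "\<gamma> \<in> \<Gamma>" for \<gamma>
  proof -
    obtain V where "finite V" "V \<subseteq> range u" "y \<gamma> \<in> span V"
      using y(1)[OF \<gamma>] by (rule in_span_finite_subset)
    then show ?thesis
      by (metis finite_subset_image)
  qed
  \<comment> \<open>Size is counted in index sets, as injectivity of \<open>u\<close> is not
    assumed.\<close>
  define Q where "Q \<gamma> n \<longleftrightarrow> (\<exists>T. finite T \<and> card T = n \<and> y \<gamma> \<in> span (u ` T))" for \<gamma> n
  define N where "N \<gamma> = (LEAST n. Q \<gamma> n)" for \<gamma>
  have N: "Q \<gamma> (N \<gamma>)" if "\<gamma> \<in> \<Gamma>" for \<gamma>
    unfolding N_def by (rule LeastI_ex) (use ex[OF that] in \<open>auto simp: Q_def\<close>)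
  have N_le: "N \<gamma> \<le> card T" if "finite T" "y \<gamma> \<in> span (u ` T)" for \<gamma> T
    unfolding N_def by (rule Least_le) (use that in \<open>auto simp: Q_def\<close>)
  have "\<exists>n. uncountable {\<gamma>\<in>\<Gamma>. N \<gamma> = n}"
  proof (rule ccontr)
    assume "\<not> ?thesis"
    then have "countable (\<Union>n. {\<gamma>\<in>\<Gamma>. N \<gamma> = n})" by blast
    moreover have "(\<Union>n. {\<gamma>\<in>\<Gamma>. N \<gamma> = n}) = \<Gamma>" by auto
    ultimately show False using unc by simp
  qed
  then obtain n where n: "uncountable {\<gamma>\<in>\<Gamma>. N \<gamma> = n}" by blast
  have "infinite \<Gamma>" using unc countable_finite by blast
  \<comment> \<open>Fewer than \<open>n\<close> vectors will have to be annihilated, so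
    \<open>Suc n\<close> functionals have a nontrivial combination that does it.\<close>
  then obtain A where A: "A \<subseteq> \<Gamma>" "finite A" "card A = Suc n"
    using infinite_arbitrarily_large by metis
  define q where "q \<gamma> = inv g (\<phi> \<gamma>)" for \<gamma>
  have q: "g (q \<gamma>) = \<phi> \<gamma>" for \<gamma>
    unfolding q_def using g by (rule surj_f_inv_f)
  \<comment> \<open>A countable initial segment containing the positions of the chosen functionals;
    every index outside it lies above all of them.\<close>
  define C where "C = (\<Union>\<gamma>\<in>A. insert (q \<gamma>) {b. (b, q \<gamma>) \<in> r})"
  have "countable C"
    unfolding C_def by (intro countable_UN countable_insert countable_finite A ctb)
  have C_down: "b \<in> C" if "a \<in> C" "(b, a) \<in> r" for a b
    using that transD[OF \<open>trans r\<close>] unfolding C_def by blast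
  have above_C: "(q \<gamma>, a) \<in> r" if "a \<notin> C" "\<gamma> \<in> A" for a \<gamma>
    using that \<open>total r\<close> unfolding C_def total_on_def by blast
  \<comment> \<open>A vector of the system indexed outside \<open>A\<close> is killed by all
    functionals indexed in \<open>A\<close>.\<close>
  let ?\<Delta> = "{\<gamma>\<in>\<Gamma>. N \<gamma> = n} - A"
  have inj: "inj_on y \<Gamma>"
    using bio by (rule biorthogonal_system_inj_on)
  \<comment> \<open>Independence prevents uncountably many of these vectors from fitting into the
    span of the countably many \<open>u c\<close> with \<open>c\<close> in \<open>C\<close>.\<close>
  have "independent (y ` ?\<Delta>)"
    unfolding dependent_def
  proof (rule notI, elim bexE)
    fix v assume v: "v \<in> y ` ?\<Delta>" "v \<in> span (y ` ?\<Delta> - {v})"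
    then obtain \<beta> where \<beta>: "\<beta> \<in> \<Gamma>" "y \<beta> \<in> span (y ` ?\<Delta> - {y \<beta>})"
      by blast
    have "span (y ` ?\<Delta> - {y \<beta>}) \<subseteq> {v. \<phi> \<beta> v = 0}"
      using \<phi> \<beta>(1) by (intro span_minimal) (auto simp: subspace_def blinfun.bilinear_simps)
    then show False
      using \<phi>[of \<beta> \<beta>] \<beta> by auto
  qed
  moreover have "uncountable (y ` ?\<Delta>)"
  proof -
    have "uncountable ?\<Delta>"
      using n A(2) by (simp add: uncountable_minus_countable countable_finite)
    moreover have "inj_on y ?\<Delta>"
      using inj by (rule inj_on_subset) auto
    ultimately show ?thesis
      by (simp add: countable_image_inj_eq)
  qed
  ultimately have "\<not> y ` ?\<Delta> \<subseteq> span (u ` C)"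
    using countable_independent_in_countable_span[OF _ _ countable_image[OF \<open>countable C\<close>]] by metis
  then obtain \<beta> where \<beta>: "\<beta> \<in> \<Gamma>" "N \<beta> = n" "\<beta> \<notin> A" "y \<beta> \<notin> span (u ` C)"
    by (auto simp: image_subset_iff)
  obtain T where T: "finite T" "card T = n" "y \<beta> \<in> span (u ` T)"
    using N[OF \<beta>(1)] \<beta>(2) by (auto simp: Q_def)
  have "\<not> T \<subseteq> C"
    using T(3) \<beta>(4) span_mono[OF image_mono, of T C u] by auto
  then have "T \<noteq> {}" by auto
  have "\<exists>a\<in>T. \<forall>b\<in>T. b \<noteq> a \<longrightarrow> (a, b) \<notin> r"
  proof (rule Finite_Set.bex_max_element[OF T(1) _ _ \<open>T \<noteq> {}\<close>])
    show "asymp_on T (\<lambda>a b. (a, b) \<in> r)"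
      using wf_not_sym[OF \<open>wf r\<close>] by (intro asymp_onI) auto
    show "transp_on T (\<lambda>a b. (a, b) \<in> r)"
      using \<open>trans r\<close> by (intro transp_onI) (auto dest: transD)
  qed
  then obtain a where "a \<in> T" and a_max: "\<And>b. b \<in> T \<Longrightarrow> b \<noteq> a \<Longrightarrow> (a, b) \<notin> r"
    by blast
  have a: "a \<in> T" "\<And>b. b \<in> T \<Longrightarrow> b \<noteq> a \<Longrightarrow> (b, a) \<in> r"
    using a_max \<open>a \<in> T\<close> \<open>total r\<close> by (auto simp: total_on_def)
  \<comment> \<open>\<open>C\<close> is closed downwards: if the largest index of \<open>T\<close>
    lay in it, so would all of \<open>T\<close>.\<close>
  have "a \<notin> C"
    using \<open>\<not> T \<subseteq> C\<close> a(2) C_down[of a] by auto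
  define S where "S = T - {a}"
  have S: "finite S" "card S < card A" "card S < n" "u ` T = insert (u a) (u ` S)"
    using T a(1) A(3) card_Diff1_less[OF T(1) a(1)] by (auto simp: S_def)
  obtain c where c: "\<exists>\<gamma>\<in>A. c \<gamma> \<noteq> 0" "\<And>s. s \<in> S \<Longrightarrow> (\<Sum>\<gamma>\<in>A. c \<gamma> * \<phi> \<gamma> (u s)) = 0"
    using homogeneous_system_nontrivial_solution[OF S(1) A(2) S(2), of "\<lambda>\<gamma> s. \<phi> \<gamma> (u s)"] by blast
  define \<psi> where "\<psi> = (\<Sum>\<gamma>\<in>A. c \<gamma> *\<^sub>R \<phi> \<gamma>)"
  have \<psi>_apply: "\<psi> v = (\<Sum>\<gamma>\<in>A. c \<gamma> * \<phi> \<gamma> v)" for v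
    by (simp add: \<psi>_def blinfun.sum_left blinfun.scaleR_left)
  have \<psi>_span: "\<psi> \<in> span (\<phi> ` A)"
    unfolding \<psi>_def by (intro span_sum span_scale span_base) auto
  have \<psi>_nonzero: "\<psi> \<noteq> 0"
  proof -
    obtain \<gamma> where \<gamma>: "\<gamma> \<in> A" "c \<gamma> \<noteq> 0" using c(1) by blast
    \<comment> \<open>By biorthogonality, evaluation at \<open>y \<gamma>\<close> isolates the
      nonzero coefficient \<open>c \<gamma>\<close>.\<close>
    have "\<psi> (y \<gamma>) = (\<Sum>\<alpha>\<in>A. if \<alpha> = \<gamma> then c \<alpha> else 0)"
      unfolding \<psi>_apply using A(1) \<gamma>(1) by (intro sum.cong) (auto simp: \<phi> subset_iff)
    then show ?thesis
      using \<gamma> A(2) by auto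
  qed
  have \<psi>_zero: "\<forall>s\<in>S. \<psi> (u s) = 0"
    using c(2) by (simp add: \<psi>_apply)
  have S_below: "S \<subseteq> {b. (b, a) \<in> r}"
    using a(2) by (auto simp: S_def)
  \<comment> \<open>All the functionals come before \<open>a\<close> in the enumeration, so
    genericity at \<open>a\<close> trades \<psi>, which may vanish at \<open>u a\<close>, for a
    \<theta> that does not.\<close>
  have "\<phi> ` A \<subseteq> g ` {b. (b, a) \<in> r}"
    using above_C[OF \<open>a \<notin> C\<close>] q[symmetric] by (intro image_subsetI image_eqI) auto
  then obtain \<theta> where \<theta>: "\<theta> \<in> span (\<phi> ` A)" "\<theta> (u a) \<noteq> 0" "\<And>s. s \<in> S \<Longrightarrow> \<theta> (u s) = 0"
    by (rule generic_familyD[OF u S(1) finite_imageI[OF A(2)] S_below _ \<psi>_span \<psi>_nonzero \<psi>_zero])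
      blast
  \<comment> \<open>\<open>k\<close> is a coefficient of \<open>u a\<close> in
    \<open>y \<beta>\<close>; it must be 0, since \<theta> kills \<open>y \<beta>\<close> and the
    other terms but not \<open>u a\<close>.\<close>
  obtain k where k: "y \<beta> - k *\<^sub>R u a \<in> span (u ` S)"
    using T(3) unfolding S(4) span_insert by auto
  have "span (u ` S) \<subseteq> {v. \<theta> v = 0}"
    using \<theta>(3) by (intro span_minimal) (auto simp: subspace_def blinfun.bilinear_simps)
  with k have "\<theta> (y \<beta>) = k * \<theta> (u a)"
    by (auto simp: blinfun.bilinear_simps)
  moreover have "span (\<phi> ` A) \<subseteq> {\<theta>. blinfun_apply \<theta> (y \<beta>) = 0}"
    using \<phi> A(1) \<beta>(1,3) by (intro span_minimal) (auto simp: subspace_def blinfun.bilinear_simps)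
  ultimately have "k = 0"
    using \<theta>(1,2) by auto
  \<comment> \<open>Fewer than \<open>n\<close> indices now suffice for \<open>y \<beta>\<close>,
    against minimality.\<close>
  with k have "y \<beta> \<in> span (u ` S)" by simp
  then show False
    using N_le[OF S(1)] S(3) \<beta>(2) by fastforce
qed

section \<open>Construction of the dense subspace\<close>

theorem theoremB:
  assumes "continuum_hypothesis"
    and "weakly_Lindelof_determined TYPE('a::banach)"
    and "has_density_character (UNIV :: 'a set) (cardSuc natLeq)"
  shows "\<exists>Y :: 'a set. subspace Y \<and> closure Y = UNIV \<and>
           \<not> has_uncountable_biorthogonal_system Y"
proof -
  obtain D :: "'a set" where D: "closure D = UNIV" "|D| =o cardSuc natLeq"
    using assms(3) unfolding has_density_character_def by auto
  then have "|D| =o |UNIV :: real set|"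
    using assms(1) unfolding continuum_hypothesis_def
    by (meson ordIso_symmetric ordIso_transitive)
  then obtain i :: "'a \<Rightarrow> real" where "inj_on i D"
    by (meson card_of_ordLeq ordIso_iff_ordLeq)
  with D(1) obtain k :: "'a \<Rightarrow> real" where k: "inj k"
    by (rule inj_into_real_of_dense)
  obtain \<Gamma> :: "'a set" and x f where M: "M_basis \<Gamma> x f"
    and supp: "\<And>\<phi> :: 'a \<Rightarrow>\<^sub>L real. countable {\<gamma>\<in>\<Gamma>. \<phi> (x \<gamma>) \<noteq> 0}"
    using assms(2) unfolding weakly_Lindelof_determined_def by blast
  have "closure (span (x ` \<Gamma>)) = UNIV"
    using M by (simp add: M_basis_def)
  from inj_dual_into_real[OF k this supp] obtain l :: "('a \<Rightarrow>\<^sub>L real) \<Rightarrow> real" where "inj l"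
    by blast
  \<comment> \<open>\<open>inv l\<close> enumerates all of X* along the index type
    \<open>real\<close>.\<close>
  then have g: "surj (inv l)"
    by (rule inj_imp_surj_inv)
  obtain j :: "(nat \<Rightarrow> real) \<Rightarrow> real" where j: "\<And>s t n. j s = j t \<Longrightarrow> s n = t n"
    by (rule inj_real_sequences) blast
  \<comment> \<open>A point and a natural number are coded as one sequence: the code of the point at
    position 0, the number at all later positions. Hence the reals can index all such pairs.\<close>
  have "inj (\<lambda>(v, n). j (\<lambda>m. if m = 0 then k v else real n))"
  proof (rule injI, clarify)
    fix v w :: 'a and n m :: nat
    assume "j (\<lambda>l. if l = 0 then k v else real n) = j (\<lambda>l. if l = 0 then k w else real m)"
    then have *: "(if l = 0 then k v else real n) = (if l = 0 then k w else real m)" for l :: nat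
      by (rule j)
    show "v = w \<and> n = m"
      using *[of 0] *[of 1] k by (simp add: inj_eq)
  qed
  then obtain e :: "real \<Rightarrow> 'a \<times> nat" where e: "surj e"
    using inj_imp_surj_inv by blast
  obtain r :: "real rel" where r: "wf r" "trans r" "total r" "\<And>a. countable {b. (b, a) \<in> r}"
    using continuum_hypothesis_wellorder[OF assms(1)] by blast
  \<comment> \<open>Every point is the centre of listed balls of all radii 1/(n+1), so any choice of
    one vector from each ball is dense.\<close>
  define B where "B a = ball (fst (e a)) (1 / real (Suc (snd (e a))))" for a
  obtain u where u: "generic_family r (inv l) u" "\<And>a. u a \<in> B a"
    using generic_family_exists[where r = r and B = B and g = "inv l"] r
    by (auto simp: B_def)
  have "v \<in> closure (range u)" for v
    unfolding closure_approachable
  proof (intro allI impI)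
    fix \<epsilon> :: real assume "\<epsilon> > 0"
    then obtain n where n: "1 / real (Suc n) < \<epsilon>"
      using nat_approx_posE by blast
    obtain a where "e a = (v, n)"
      using e by (metis surjD)
    then have "dist (u a) v < 1 / real (Suc n)"
      using u(2)[of a] by (simp add: B_def dist_commute)
    with n have "dist (u a) v < \<epsilon>"
      by (rule less_trans[rotated])
    then show "\<exists>w\<in>range u. dist w v < \<epsilon>"
      by blast
  qed
  then have "closure (span (range u)) = UNIV"
    using closure_mono[OF span_superset, of "range u"] by auto
  moreover from this have "\<not> has_uncountable_biorthogonal_system (span (range u))"
    using generic_family_span_no_uncountable_biorthogonal_system[OF r g u(1)] by blast
  ultimately show ?thesis
    using subspace_span by blast
qed

end
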